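(* Suppose $h_1,h_2$ is a free basis for $\mathbb{C}[x,x^{-1}]$ as a module over $\mathbb{C}[x,x^{-1}]^W$, and let $m_1,m_2$ be the dual basis. Then given any two functions $g_1,g_2:\mathbb{Z}\to\mathbb{C}$, there is a unique $u:\mathbb{Z}^2\to\mathbb{C}$ satisfying the wave equation $$u(n,t+1)+u(n,t-1)=u(n+1,t)+u(n-1,t)\qquad(n,t\in\mathbb{Z})$$ with initial conditions $$[y^0]\big(u^{[y]}(n,\cdot)\cdot h_1(y^{-1})\big)=g_1(n),\qquad [y^0]\big(u^{[y]}(n,\cdot)\cdot h_2(y^{-1})\big)=g_2(n)\qquad(n\in\mathbb{Z}),$$ and it is given by $$u(n,t)=[x^n]\Big(g_1^{[x]}\cdot(m_1,x^t)+g_2^{[x]}\cdot(m_2,x^t)\Big).$$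
   Context: $W=\{1,w_0\}$ acts on $\mathbb{C}[x,x^{-1}]$ by $w_0:x\mapsto x^{-1}$, so $\mathbb{C}[x,x^{-1}]^W=\mathbb{C}[x+x^{-1}]$; $\mathbb{C}[x,x^{-1}]$ is free of rank 2 over it. The symmetric $\mathbb{C}[x,x^{-1}]^W$-bilinear pairing $(f,g):=\frac{fg-w_0(fg)}{x-x^{-1}}$ takes values in $\mathbb{C}[x,x^{-1}]^W$ and is perfect; the dual basis $m_1,m_2$ of $h_1,h_2$ is determined by $(m_i,h_j)=\delta_{ij}$. For $g:\mathbb{Z}\to\mathbb{C}$, $g^{[x]}=\sum_{n\in\mathbb{Z}}g(n)x^n$ is a formal bi-infinite Laurent series, which may be multiplied by Laurent polynomials; $[x^n]j(x)$ is the coefficient of $x^n$ in $j(x)$. For $u:\mathbb{Z}^2\to\mathbb{C}$, $u^{[y]}(n,\cdot)=\sum_{t\in\mathbb{Z}}u(n,t)y^t$. Thus if $h=\sum_ic_ix^i$ then $[y^0](u^{[y]}(n,\cdot)h(y^{-1}))=\sum_ic_iu(n,i)$. *)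

theory Defs
  imports Complex_Main "HOL-Library.Poly_Mapping"
begin

text \<open>Finitely supported functions on the integers, with the convolution product of
  \<^theory>\<open>HOL-Library.Poly_Mapping\<close>, form the group algebra of the integers, that is, the ring of
  Laurent polynomials; \<^term>\<open>Poly_Mapping.lookup f n\<close> is the coefficient of \<open>x\<^sup>n\<close> in \<open>f\<close>.\<close>

type_synonym laurent_poly = "int \<Rightarrow>\<^sub>0 complex"

definition X_pow :: "int \<Rightarrow> laurent_poly" where
  "X_pow n = Poly_Mapping.single n 1"

definition w0 :: "laurent_poly \<Rightarrow> laurent_poly" where
  "w0 f = Poly_Mapping.map_key uminus f"

definition W_invariants :: "laurent_poly set" where
  "W_invariants = {f. w0 f = f}"

text \<open>The quotient in the definition of the pairing is the exact one in the ring of Laurent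
  polynomials (which is a domain); see \<open>pairing_times\<close> and \<open>pairing_eqI\<close> below.\<close>

definition pairing :: "laurent_poly \<Rightarrow> laurent_poly \<Rightarrow> laurent_poly" where
  "pairing f g = (THE q. q * (X_pow 1 - X_pow (-1)) = f * g - w0 (f * g))"

definition is_free_basis :: "laurent_poly \<Rightarrow> laurent_poly \<Rightarrow> bool" where
  "is_free_basis h1 h2 \<longleftrightarrow>
     (\<forall>f. \<exists>!(a, b). a \<in> W_invariants \<and> b \<in> W_invariants \<and> f = a * h1 + b * h2)"

definition is_dual_basis ::
    "laurent_poly \<Rightarrow> laurent_poly \<Rightarrow> laurent_poly \<Rightarrow> laurent_poly \<Rightarrow> bool" where
  "is_dual_basis m1 m2 h1 h2 \<longleftrightarrow>
     pairing m1 h1 = 1 \<and> pairing m1 h2 = 0 \<and> pairing m2 h1 = 0 \<and> pairing m2 h2 = 1"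

lemma lookup_w0: "Poly_Mapping.lookup (w0 f) n = Poly_Mapping.lookup f (- n)"
  unfolding w0_def by (subst map_key.rep_eq) (auto simp: inj_def)

lemma X_pow_add: "X_pow (m + n) = X_pow m * X_pow n"
  by (simp add: X_pow_def mult_single)

lemma w0_X_pow: "w0 (X_pow n) = X_pow (- n)"
  by (rule poly_mapping_eqI) (auto simp: lookup_w0 X_pow_def lookup_single when_def)

lemma w0_add: "w0 (f + g) = w0 f + w0 g"
  by (rule poly_mapping_eqI) (simp add: lookup_w0 lookup_add)

lemma X_pow_denominator_nonzero: "X_pow 1 - X_pow (-1) \<noteq> 0"
proof
  assume "X_pow 1 - X_pow (-1) = 0"
  hence "Poly_Mapping.lookup (X_pow 1) 1 = Poly_Mapping.lookup (X_pow (-1)) 1" by simp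
  thus False by (simp add: X_pow_def lookup_single when_def)
qed

lemma X_pow_antisym_dvd_nat: "(X_pow 1 - X_pow (-1)) dvd (X_pow (int n) - X_pow (- int n))"
proof (induction n)
  case (Suc n)
  have "X_pow (int (Suc n)) - X_pow (- int (Suc n)) =
      X_pow 1 * (X_pow (int n) - X_pow (- int n)) + X_pow (- int n) * (X_pow 1 - X_pow (-1))"
    by (simp add: algebra_simps flip: X_pow_add)
  with Suc show ?case by (metis dvd_add dvd_mult dvd_triv_right)
qed simp

lemma X_pow_antisym_dvd: "(X_pow 1 - X_pow (-1)) dvd (X_pow n - X_pow (- n))"
proof (cases "n \<ge> 0")
  case True
  then show ?thesis using X_pow_antisym_dvd_nat[of "nat n"] by simp
next
  case False
  then have "(X_pow 1 - X_pow (-1)) dvd (X_pow (- n) - X_pow n)"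
    using X_pow_antisym_dvd_nat[of "nat (- n)"] by simp
  then have "(X_pow 1 - X_pow (-1)) dvd - (X_pow (- n) - X_pow n)"
    by (rule dvd_minus_iff[THEN iffD2])
  then show ?thesis by (simp only: minus_diff_eq)
qed

lemma antisym_dvd: "(X_pow 1 - X_pow (-1)) dvd (f - w0 f)"
proof (induction f rule: update_induct)
  case const
  have "w0 0 = 0" by (rule poly_mapping_eqI) (simp add: lookup_w0)
  thus ?case by simp
next
  case (update f k c)
  have upd: "Poly_Mapping.update k c f = f + Poly_Mapping.single k c"
    using update.hyps(1)
    by (intro poly_mapping_eqI)
      (auto simp: lookup_update lookup_add lookup_single when_def in_keys_iff)
  have "Poly_Mapping.single k c = Poly_Mapping.single 0 c * X_pow k"
    by (simp add: X_pow_def mult_single)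
  moreover have "w0 (Poly_Mapping.single k c) = Poly_Mapping.single 0 c * X_pow (- k)"
    by (rule poly_mapping_eqI) (auto simp: X_pow_def mult_single lookup_w0 lookup_single when_def)
  ultimately have "Poly_Mapping.update k c f - w0 (Poly_Mapping.update k c f)
      = (f - w0 f) + Poly_Mapping.single 0 c * (X_pow k - X_pow (- k))"
    by (simp add: upd w0_add algebra_simps)
  with update.IH X_pow_antisym_dvd show ?case by (metis dvd_add dvd_mult)
qed

lemma pairing_eqI:
  assumes "q * (X_pow 1 - X_pow (-1)) = f * g - w0 (f * g)"
  shows "pairing f g = q"
  unfolding pairing_def
proof (rule the_equality)
  fix q' assume "q' * (X_pow 1 - X_pow (-1)) = f * g - w0 (f * g)"
  with assms have "q' * (X_pow 1 - X_pow (-1)) = q * (X_pow 1 - X_pow (-1))" by simp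
  thus "q' = q" using X_pow_denominator_nonzero by simp
qed (rule assms)

lemma pairing_times: "pairing f g * (X_pow 1 - X_pow (-1)) = f * g - w0 (f * g)"
proof -
  obtain q where "f * g - w0 (f * g) = (X_pow 1 - X_pow (-1)) * q"
    using antisym_dvd by (blast elim: dvdE)
  hence "q * (X_pow 1 - X_pow (-1)) = f * g - w0 (f * g)" by (simp add: mult.commute)
  thus ?thesis using pairing_eqI by metis
qed

text \<open>\<^term>\<open>Series g\<close> is the formal series with coefficient function \<^term>\<open>g\<close>, so it renders both
  \<open>g\<^bsup>[x]\<^esup>\<close> and, for \<^term>\<open>g = u n\<close>, the series \<open>u\<^bsup>[y]\<^esup>(n,\<cdot>)\<close>;
  \<^term>\<open>coeff j n\<close> is \<open>[x\<^sup>n] j(x)\<close>.\<close>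

datatype bi_series = Series (coeff: "int \<Rightarrow> complex")

instantiation bi_series :: plus
begin
definition plus_bi_series :: "bi_series \<Rightarrow> bi_series \<Rightarrow> bi_series" where
  "a + b = Series (\<lambda>n. coeff a n + coeff b n)"
instance ..
end

definition times_laurent :: "bi_series \<Rightarrow> laurent_poly \<Rightarrow> bi_series" (infixl "\<odot>" 70) where
  "a \<odot> p = Series (\<lambda>n. \<Sum>k\<in>Poly_Mapping.keys p. Poly_Mapping.lookup p k * coeff a (n - k))"

definition wave_equation :: "(int \<Rightarrow> int \<Rightarrow> complex) \<Rightarrow> bool" where
  "wave_equation u \<longleftrightarrow> (\<forall>n t. u n (t + 1) + u n (t - 1) = u (n + 1) t + u (n - 1) t)"

text \<open>\<^term>\<open>w0 h\<close>, read in the variable \<open>y\<close>, is \<open>h(y\<^bsup>-1\<^esup>)\<close>.\<close>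

definition initial_condition ::
    "(int \<Rightarrow> int \<Rightarrow> complex) \<Rightarrow> laurent_poly \<Rightarrow> (int \<Rightarrow> complex) \<Rightarrow> bool" where
  "initial_condition u h g \<longleftrightarrow> (\<forall>n. coeff (Series (u n) \<odot> w0 h) 0 = g n)"

end

theory Submission
  imports Defs
begin

text \<open>A function \<open>u\<close> on \<open>\<int>\<^sup>2\<close> is the same thing as a \<open>\<complex>\<close>-linear map from Laurent polynomials
  to series, sending \<open>x\<^sup>t\<close> to the series in \<open>n\<close> with coefficients \<open>u(n, t)\<close>; its value at \<open>h\<close> has
  coefficients \<open>[y\<^sup>0](u\<^bsup>[y]\<^esup>(n,\<cdot>) h(y\<^bsup>-1\<^esup>))\<close>. Under this dictionary the wave equation says that
  the map commutes with multiplication by \<open>x + x\<^bsup>-1\<^esup>\<close>, hence that it is linear over all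
  \<open>W\<close>-invariants (\<open>lin_ext_wave\<close>), and the initial conditions prescribe its values
  \<open>g\<^sub>1, g\<^sub>2\<close> at \<open>h\<^sub>1, h\<^sub>2\<close>. A linear map is determined by arbitrary values on a free basis,
  whence existence and uniqueness.

  The formula is the expansion of \<open>x\<^sup>t\<close> in the basis: the pairing is linear over invariants, so
  \<open>x\<^sup>t = a h\<^sub>1 + b h\<^sub>2\<close> forces \<open>a = (m\<^sub>1, x\<^sup>t)\<close> and \<open>b = (m\<^sub>2, x\<^sup>t)\<close>. Conversely the function
  given by the formula corresponds to the map \<open>f \<mapsto> g\<^sub>1 \<cdot> (m\<^sub>1, f) + g\<^sub>2 \<cdot> (m\<^sub>2, f)\<close>, which is linear
  over invariants and takes the right values at \<open>h\<^sub>1\<close> and \<open>h\<^sub>2\<close>.\<close>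

section \<open>Induction over Laurent polynomials\<close>

lemma laurent_poly_induct [case_names single sum]:
  fixes f :: laurent_poly
  assumes single: "\<And>k c. P (Poly_Mapping.single k c)"
    and sum: "\<And>f g. P f \<Longrightarrow> P g \<Longrightarrow> P (f + g)"
  shows "P f"
proof (induction f rule: update_induct)
  case const
  show ?case using single[of 0 0] by simp
next
  case (update f k c)
  have "Poly_Mapping.update k c f = f + Poly_Mapping.single k c"
    using update.hyps(1)
    by (intro poly_mapping_eqI)
      (auto simp: lookup_update lookup_add lookup_single when_def in_keys_iff)
  then show ?case using update.IH single sum by simp
qed

section \<open>Linear functionals on Laurent polynomials\<close>

text \<open>The linear functional on Laurent polynomials that sends \<open>x\<^sup>k\<close> to \<open>v k\<close>.\<close>

definition lin_ext :: "(int \<Rightarrow> complex) \<Rightarrow> laurent_poly \<Rightarrow> complex" where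
  "lin_ext v h = (\<Sum>k\<in>Poly_Mapping.keys h. Poly_Mapping.lookup h k * v k)"

lemma lin_ext_superset:
  assumes "finite A" and "Poly_Mapping.keys h \<subseteq> A"
  shows "lin_ext v h = (\<Sum>k\<in>A. Poly_Mapping.lookup h k * v k)"
  unfolding lin_ext_def using assms
  by (intro sum.mono_neutral_left) (auto simp: in_keys_iff)

lemma lin_ext_add: "lin_ext v (f + g) = lin_ext v f + lin_ext v g"
proof -
  let ?A = "Poly_Mapping.keys f \<union> Poly_Mapping.keys g"
  have "lin_ext v (f + g) = (\<Sum>k\<in>?A. Poly_Mapping.lookup (f + g) k * v k)"
    by (intro lin_ext_superset) (use Poly_Mapping.keys_add[of f g] in auto)
  also have "\<dots> = (\<Sum>k\<in>?A. Poly_Mapping.lookup f k * v k) + (\<Sum>k\<in>?A. Poly_Mapping.lookup g k * v k)"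
    by (simp add: lookup_add distrib_right sum.distrib)
  also have "\<dots> = lin_ext v f + lin_ext v g"
    by (simp add: lin_ext_superset[of ?A])
  finally show ?thesis .
qed

lemma lin_ext_single [simp]: "lin_ext v (Poly_Mapping.single k c) = c * v k"
  by (simp add: lin_ext_def)

lemma lin_ext_X_pow [simp]: "lin_ext v (X_pow k) = v k"
  by (simp add: X_pow_def)

lemma lin_ext_0 [simp]: "lin_ext v 0 = 0"
  by (simp add: lin_ext_def)

lemma lin_ext_1 [simp]: "lin_ext v 1 = v 0"
  by (simp flip: single_one)

lemma lin_ext_add_fun: "lin_ext (\<lambda>k. v k + w k) h = lin_ext v h + lin_ext w h"
  by (simp add: lin_ext_def distrib_left sum.distrib)

lemma lin_ext_cmult_fun: "lin_ext (\<lambda>k. c * v k) h = c * lin_ext v h"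
  by (simp add: lin_ext_def sum_distrib_left mult.left_commute)

lemma lin_ext_swap:
  "lin_ext (\<lambda>k. lin_ext (\<lambda>t. F k t) f) a = lin_ext (\<lambda>t. lin_ext (\<lambda>k. F k t) a) f"
  unfolding lin_ext_def sum_distrib_left
  by (subst sum.swap) (simp add: mult.left_commute)

text \<open>For \<open>f = a\<close> an invariant and \<open>v = u(n, \<cdot>)\<close> this expresses the value at a product \<open>a g\<close> through
  shifts of \<open>u\<close> in \<open>t\<close>, which the wave equation then turns into shifts in \<open>n\<close>. For
  \<open>v k = w (n - k)\<close>, with \<open>w\<close> the coefficients of a series, it is the associativity of the action of Laurent polynomials on series.\<close>

lemma lin_ext_mult: "lin_ext v (f * g) = lin_ext (\<lambda>k. lin_ext (\<lambda>t. v (k + t)) g) f"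
proof (induction f rule: laurent_poly_induct)
  case (single k c)
  show ?case
  proof (induction g rule: laurent_poly_induct)
    case (sum f g)
    then show ?case by (simp add: distrib_left lin_ext_add)
  qed (simp add: mult_single mult.assoc)
qed (simp add: distrib_right lin_ext_add)

lemma w0_single: "w0 (Poly_Mapping.single k c) = Poly_Mapping.single (- k) c"
  by (rule poly_mapping_eqI) (auto simp: lookup_w0 lookup_single when_def)

lemma lin_ext_w0: "lin_ext v (w0 f) = lin_ext (\<lambda>k. v (- k)) f"
proof (induction f rule: laurent_poly_induct)
  case (single k c)
  show ?case by (simp add: w0_single)
qed (simp add: w0_add lin_ext_add)

lemma coeff_times_laurent: "coeff (Series g \<odot> p) n = lin_ext (\<lambda>k. g (n - k)) p"
  by (simp add: times_laurent_def lin_ext_def)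

lemma coeff_plus: "coeff (a + b) n = coeff a n + coeff b n"
  by (simp add: plus_bi_series_def)

lemma initial_condition_iff_lin_ext: "initial_condition u h g \<longleftrightarrow> (\<forall>n. lin_ext (u n) h = g n)"
  by (simp add: initial_condition_def coeff_times_laurent lin_ext_w0)

section \<open>Linearity of the pairing over invariants\<close>

lemma w0_mult: "w0 (f * g) = w0 f * w0 g"
proof (induction f rule: laurent_poly_induct)
  case (single k c)
  show ?case
  proof (induction g rule: laurent_poly_induct)
    case (sum f g)
    then show ?case by (simp add: distrib_left w0_add)
  qed (simp add: mult_single w0_single)
qed (simp add: distrib_right w0_add)

lemma pairing_add: "pairing m (f + g) = pairing m f + pairing m g"
  by (rule pairing_eqI) (simp add: distrib_right distrib_left pairing_times w0_add)

lemma pairing_invariant_mult: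
  assumes "a \<in> W_invariants"
  shows "pairing m (a * f) = a * pairing m f"
proof (rule pairing_eqI)
  have "w0 a = a" using assms by (simp add: W_invariants_def)
  then have "m * (a * f) - w0 (m * (a * f)) = a * (m * f - w0 (m * f))"
    by (simp add: w0_mult algebra_simps)
  then show "a * pairing m f * (X_pow 1 - X_pow (- 1)) = m * (a * f) - w0 (m * (a * f))"
    by (simp add: pairing_times mult.assoc)
qed

text \<open>This identifies the linear map that belongs to \<open>u(n, t) = [x\<^sup>n](g\<^bsup>[x]\<^esup> \<cdot> (m, x\<^sup>t))\<close>: its
  value at \<open>h\<close> is \<open>g\<^bsup>[x]\<^esup> \<cdot> (m, h)\<close>, since the pairing is linear over the constants in particular.\<close>

lemma lin_ext_pairing: "lin_ext (\<lambda>t. lin_ext v (pairing m (X_pow t))) h = lin_ext v (pairing m h)"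
proof (induction h rule: laurent_poly_induct)
  case (single k c)
  have "Poly_Mapping.single 0 c \<in> W_invariants"
    by (simp add: W_invariants_def w0_single)
  moreover have "Poly_Mapping.single k c = Poly_Mapping.single 0 c * X_pow k"
    by (simp add: X_pow_def mult_single)
  ultimately have "pairing m (Poly_Mapping.single k c) = Poly_Mapping.single 0 c * pairing m (X_pow k)"
    by (simp add: pairing_invariant_mult)
  then show ?case by (simp add: lin_ext_mult)
qed (simp add: lin_ext_add pairing_add)

section \<open>The wave equation as linearity over invariants\<close>

text \<open>Applying \<open>x\<^sup>k + x\<^bsup>-k\<^esup>\<close> in the \<open>t\<close> variable or in the \<open>n\<close> variable gives the same result,
  because \<open>x\<^sup>k + x\<^bsup>-k\<^esup>\<close> is a polynomial in \<open>x + x\<^bsup>-1\<^esup>\<close>. The induction follows the Chebyshev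
  recursion \<open>(x + x\<^bsup>-1\<^esup>)(x\<^sup>k + x\<^bsup>-k\<^esup>) = (x\<^bsup>k+1\<^esup> + x\<^bsup>-k-1\<^esup>) + (x\<^bsup>k-1\<^esup> + x\<^bsup>1-k\<^esup>)\<close>.\<close>

lemma wave_equation_steps_nat:
  assumes "wave_equation u"
  shows "u n (t + int k) + u n (t - int k) = u (n + int k) t + u (n - int k) t"
proof (induction k arbitrary: n t rule: less_induct)
  case (less k)
  have w: "u n (t + 1) + u n (t - 1) = u (n + 1) t + u (n - 1) t" for n t
    using assms by (simp add: wave_equation_def)
  consider "k = 0" | "k = 1" | j where "k = Suc (Suc j)"
    by (metis One_nat_def not0_implies_Suc)
  then show ?case
  proof cases
    case 3
    let ?j = "int j"
    have "u n (t + ?j + 2) + u n (t - ?j) = u (n + ?j + 1) (t + 1) + u (n - ?j - 1) (t + 1)"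
      using less.IH[of "Suc j" n "t + 1"] 3 by (simp add: algebra_simps)
    moreover have "u n (t + ?j) + u n (t - ?j - 2) = u (n + ?j + 1) (t - 1) + u (n - ?j - 1) (t - 1)"
      using less.IH[of "Suc j" n "t - 1"] 3 by (simp add: algebra_simps)
    moreover have "u (n + ?j + 1) (t + 1) + u (n + ?j + 1) (t - 1) = u (n + ?j + 2) t + u (n + ?j) t"
      using w[of "n + ?j + 1" t] by (simp add: algebra_simps)
    moreover have "u (n - ?j - 1) (t + 1) + u (n - ?j - 1) (t - 1) = u (n - ?j) t + u (n - ?j - 2) t"
      using w[of "n - ?j - 1" t] by (simp add: algebra_simps)
    moreover have "u n (t + ?j) + u n (t - ?j) = u (n + ?j) t + u (n - ?j) t"
      using less.IH[of j n t] 3 by simp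
    ultimately have "u n (t + ?j + 2) + u n (t - ?j - 2) = u (n + ?j + 2) t + u (n - ?j - 2) t"
      by algebra
    then show ?thesis using 3 by (simp add: algebra_simps)
  qed (use w[of n t] in simp_all)
qed

lemma wave_equation_steps:
  assumes "wave_equation u"
  shows "u n (t + k) + u n (t - k) = u (n + k) t + u (n - k) t"
  using wave_equation_steps_nat[OF assms, of n t "nat k"]
    wave_equation_steps_nat[OF assms, of n t "nat (- k)"]
  by (cases "k \<ge> 0") (simp_all add: add.commute[of "u n (t + k)"] add.commute[of "u (n + k) t"])

lemma lin_ext_invariant_odd:
  assumes "a \<in> W_invariants" and "\<And>k. v (- k) = - v k"
  shows "lin_ext v a = 0"
proof -
  have "lin_ext v a = lin_ext v (w0 a)" using assms(1) by (simp add: W_invariants_def)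
  also have "\<dots> = lin_ext (\<lambda>k. - 1 * v k) a" by (simp add: lin_ext_w0 assms(2))
  also have "\<dots> = - lin_ext v a" by (subst lin_ext_cmult_fun) simp
  finally show ?thesis by simp
qed

text \<open>A solution of the wave equation is a linear map over invariants. By bilinearity it suffices
  to compare the two sides at \<open>f = x\<^sup>t\<close>, where the difference pairs \<open>a\<close>, whose coefficients are
  even, with the function \<open>k \<mapsto> u(n, t + k) - u(n - k, t)\<close>, which is odd.\<close>

lemma lin_ext_wave:
  assumes "wave_equation u" and "a \<in> W_invariants"
  shows "lin_ext (u n) (a * f) = lin_ext (\<lambda>k. lin_ext (u (n - k)) f) a"
proof -
  have "lin_ext (\<lambda>k. u n (k + t)) a = lin_ext (\<lambda>k. u (n - k) t) a" for t
  proof -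
    have "lin_ext (\<lambda>k. u n (k + t) + - 1 * u (n - k) t) a = 0"
    proof (rule lin_ext_invariant_odd[OF assms(2)])
      show "u n (- k + t) + - 1 * u (n - - k) t = - (u n (k + t) + - 1 * u (n - k) t)" for k
        using wave_equation_steps[OF assms(1), of n t k] by (simp add: algebra_simps)
    qed
    then show ?thesis unfolding lin_ext_add_fun lin_ext_cmult_fun by simp
  qed
  then have "lin_ext (\<lambda>t. lin_ext (\<lambda>k. u n (k + t)) a) f = lin_ext (\<lambda>t. lin_ext (\<lambda>k. u (n - k) t) a) f"
    by simp
  then show ?thesis
    by (subst lin_ext_mult, subst (1 2) lin_ext_swap)
qed

text \<open>The map \<open>f \<mapsto> g\<^bsup>[x]\<^esup> \<cdot> (m, f)\<close> commutes with multiplication by the invariant \<open>x + x\<^bsup>-1\<^esup>\<close>,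
  because the pairing does; evaluated at \<open>f = x\<^sup>t\<close>, this is the wave equation.\<close>

lemma wave_equation_pairing:
  "wave_equation (\<lambda>n t. lin_ext (\<lambda>k. g (n - k)) (pairing m (X_pow t)))"
  unfolding wave_equation_def
proof (intro allI)
  fix n t :: int
  let ?s = "X_pow 1 + X_pow (- 1)"
  have "?s \<in> W_invariants"
    by (simp add: W_invariants_def w0_add w0_X_pow add.commute)
  moreover have "X_pow (t + 1) + X_pow (t - 1) = ?s * X_pow t"
    by (simp add: distrib_right add.commute flip: X_pow_add)
  ultimately have "pairing m (X_pow (t + 1)) + pairing m (X_pow (t - 1)) = ?s * pairing m (X_pow t)"
    by (metis pairing_add pairing_invariant_mult)
  then have "lin_ext (\<lambda>k. g (n - k)) (pairing m (X_pow (t + 1)))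
      + lin_ext (\<lambda>k. g (n - k)) (pairing m (X_pow (t - 1)))
      = lin_ext (\<lambda>k. g (n - k)) (?s * pairing m (X_pow t))"
    by (metis lin_ext_add)
  then show "lin_ext (\<lambda>k. g (n - k)) (pairing m (X_pow (t + 1)))
      + lin_ext (\<lambda>k. g (n - k)) (pairing m (X_pow (t - 1)))
      = lin_ext (\<lambda>k. g (n + 1 - k)) (pairing m (X_pow t))
      + lin_ext (\<lambda>k. g (n - 1 - k)) (pairing m (X_pow t))"
    by (simp add: lin_ext_mult lin_ext_add algebra_simps)
qed

lemma wave_equation_add:
  assumes "wave_equation u" and "wave_equation v"
  shows "wave_equation (\<lambda>n t. u n t + v n t)"
  unfolding wave_equation_def
proof (intro allI)
  fix n t
  have "u n (t + 1) + u n (t - 1) = u (n + 1) t + u (n - 1) t"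
    and "v n (t + 1) + v n (t - 1) = v (n + 1) t + v (n - 1) t"
    using assms by (simp_all add: wave_equation_def)
  then show "u n (t + 1) + v n (t + 1) + (u n (t - 1) + v n (t - 1))
      = u (n + 1) t + v (n + 1) t + (u (n - 1) t + v (n - 1) t)"
    by algebra
qed

section \<open>Solving the initial value problem\<close>

text \<open>The coefficients of \<open>f\<close> in a basis are its pairings with the dual basis, as one sees by pairing
  \<open>f = a h\<^sub>1 + b h\<^sub>2\<close> with \<open>m\<^sub>1\<close> and \<open>m\<^sub>2\<close>.\<close>

lemma dual_basis_expansion:
  assumes "is_free_basis h1 h2" and "is_dual_basis m1 m2 h1 h2"
  shows "pairing m1 f \<in> W_invariants" and "pairing m2 f \<in> W_invariants"
    and "f = pairing m1 f * h1 + pairing m2 f * h2"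
proof -
  obtain a b where ab: "a \<in> W_invariants" "b \<in> W_invariants" "f = a * h1 + b * h2"
    using assms(1) unfolding is_free_basis_def by blast
  have "pairing m1 f = a" "pairing m2 f = b"
    using assms(2) ab by (simp_all add: is_dual_basis_def pairing_add pairing_invariant_mult)
  then show "pairing m1 f \<in> W_invariants" "pairing m2 f \<in> W_invariants"
    "f = pairing m1 f * h1 + pairing m2 f * h2" using ab by auto
qed

theorem theorem2p4:
  fixes h1 h2 m1 m2 :: laurent_poly and g1 g2 :: "int \<Rightarrow> complex"
  assumes "is_free_basis h1 h2"
    and "is_dual_basis m1 m2 h1 h2"
  shows "(\<exists>!u. wave_equation u \<and> initial_condition u h1 g1 \<and> initial_condition u h2 g2) \<and>
    (\<forall>u. wave_equation u \<and> initial_condition u h1 g1 \<and> initial_condition u h2 g2 \<longrightarrow>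
      (\<forall>n t. u n t =
        coeff (Series g1 \<odot> pairing m1 (X_pow t) + Series g2 \<odot> pairing m2 (X_pow t)) n))"
proof -
  let ?sol = "\<lambda>u. wave_equation u \<and> initial_condition u h1 g1 \<and> initial_condition u h2 g2"
  define U where "U = (\<lambda>n t. lin_ext (\<lambda>k. g1 (n - k)) (pairing m1 (X_pow t))
    + lin_ext (\<lambda>k. g2 (n - k)) (pairing m2 (X_pow t)))"
  have U_coeff: "U n t =
      coeff (Series g1 \<odot> pairing m1 (X_pow t) + Series g2 \<odot> pairing m2 (X_pow t)) n" for n t
    by (simp add: U_def coeff_plus coeff_times_laurent)
  have "wave_equation U"
    unfolding U_def by (intro wave_equation_add wave_equation_pairing)
  moreover have "lin_ext (U n) h = lin_ext (\<lambda>k. g1 (n - k)) (pairing m1 h)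
      + lin_ext (\<lambda>k. g2 (n - k)) (pairing m2 h)" for n h
    by (simp add: U_def lin_ext_add_fun lin_ext_pairing)
  ultimately have U_sol: "?sol U"
    using assms(2) by (simp add: initial_condition_iff_lin_ext is_dual_basis_def)
  have sol_unique: "u = U" if "?sol u" for u
  proof (intro ext)
    fix n t
    note expansion = dual_basis_expansion[OF assms, of "X_pow t"]
    have "u n t = lin_ext (u n) (pairing m1 (X_pow t) * h1 + pairing m2 (X_pow t) * h2)"
      by (simp flip: expansion(3))
    also have "\<dots> = lin_ext (\<lambda>k. lin_ext (u (n - k)) h1) (pairing m1 (X_pow t))
        + lin_ext (\<lambda>k. lin_ext (u (n - k)) h2) (pairing m2 (X_pow t))"
      using that expansion(1,2) by (simp add: lin_ext_add lin_ext_wave)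
    also have "\<dots> = U n t"
      using that by (simp add: U_def initial_condition_iff_lin_ext)
    finally show "u n t = U n t" .
  qed
  show ?thesis using U_sol U_coeff sol_unique by metis
qed

end
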